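(* Let $\mathfrak B$ be a Banach space, $f\in C(\mathbb R,\mathfrak B)$, $F\in C(\mathbb R\times\mathfrak B,\mathfrak B)$ with $F(t,0)=0$ for all $t\in\mathbb R$, $A\in C(\mathbb R,[\mathfrak B])$, and $\tau_0>0$. Assume: 1) the linear equation $x'=A(t)x$ has an exponential trichotomy on $\mathbb R$ with projections $P,Q$ and constants $\mathcal N\ge1$, $\nu>0$; 2) the functions $A$, $f$ and $F$ are Lagrange stable; 3) $|F(t,u_1)-F(t,u_2)|\le L|u_1-u_2|$ for all $t\in\mathbb R$, $u_1,u_2\in\mathfrak B$, with a constant $L<\frac{\nu}{2\mathcal N}$; 4) (Condition (C)) the family of projections $\{U(t,A)PU^{-1}(t,A)\}_{t\in\mathbb R}$ is a precompact subset of $[\mathfrak B]$. Let $\varphi$ be the Lagrange stable solution of $u'=A(t)u+f(t)+F(t,u)$ on $\mathbb R$ defined by $$\varphi(t)=\int_{-\infty}^{+\infty}G_A(t,\tau)\bigl[f(\tau)+F(\tau,\varphi(\tau))\bigr]\,d\tau\quad(t\in\mathbb R),$$ where $G_A$ is the Green function associated with the trichotomy, and let $Q_\varphi:=\overline{\varphi(\mathbb R)}$. If the functions $A$, $f$ and $F_{Q_\varphi}:=F|_{\mathbb R\times Q_\varphi}$ are two-sided remotely stationary (respectively, two-sided remotely $\tau_0$-periodic, two-sided remotely almost periodic), then $\varphi$ is two-sided remotely stationary (respectively, two-sided remotely $\tau_0$-periodic, two-sided remotely almost periodic).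
   Context: $\mathfrak B$ is a real or complex Banach space with norm $|\cdot|$; $[\mathfrak B]$ is the Banach space of bounded linear operators on $\mathfrak B$ with the operator norm. For a metric space $E$, $C(\mathbb R,E)$ carries the topology of uniform convergence on compact sets, and $C(\mathbb R\times\mathfrak B,\mathfrak B)$ carries the compact-open topology; $g^h(t):=g(t+h)$ and $F^h(t,x):=F(t+h,x)$. A function $g$ in one of these spaces is Lagrange stable if the set of its translates $\{g^h:h\in\mathbb R\}$ is precompact in that space. A set $S\subseteq\mathbb R$ is relatively dense in $\mathbb R$ if there is $l>0$ with $[a,a+l]\cap S\neq\emptyset$ for all $a\in\mathbb R$. For a metric space $(E,\rho)$, a function $g\in C(\mathbb R,E)$ is: two-sided remotely almost periodic if for every $\varepsilon>0$ there is a relatively dense set $\mathcal P(\varepsilon,g)\subseteq\mathbb R$ such that for every $s\in\mathcal P(\varepsilon,g)$ there is $\ell(\varepsilon,g,s)>0$ with $\rho(g(t+s),g(t))<\varepsilon$ for all $|t|\ge \ell(\varepsilon,g,s)$; two-sided remotely $\tau_0$-periodic if $\lim_{|t|\to\infty}\rho(g(t+\tau_0),g(t))=0$; two-sided remotely stationary if it is two-sided remotely $s$-periodic for every $s>0$. For a compact set $K\subset\mathfrak B$ and a function $F_K\in C(\mathbb R\times K,\mathfrak B)$ the same notions are understood uniformly with respect to $x\in K$, i.e. with $\rho(g(t+s),g(t))$ replaced by $\sup_{x\in K}|F_K(t+s,x)-F_K(t,x)|$. $U(t,A)$ denotes the Cauchy operator of $x'=A(t)x$ (so $U(0,A)=I$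 and $t\mapsto U(t,A)x$ is the solution with value $x$ at $t=0$). The equation $x'=A(t)x$ has an exponential trichotomy on $\mathbb R$ with projections $P,Q$ and constants $\mathcal N\ge1$, $\nu>0$ if $P,Q$ are bounded linear projections on $\mathfrak B$ with $PQ=QP$, $P+Q-PQ=I$ and $\|U(t,A)PU^{-1}(\tau,A)\|\le\mathcal N e^{-\nu(t-\tau)}$ for $0\le\tau\le t$; $\|U(t,A)(I-P)U^{-1}(\tau,A)\|\le\mathcal N e^{-\nu(\tau-t)}$ for $t\le\tau$, $\tau\ge0$; $\|U(t,A)QU^{-1}(\tau,A)\|\le\mathcal N e^{-\nu(\tau-t)}$ for $t\le\tau\le0$; $\|U(t,A)(I-Q)U^{-1}(\tau,A)\|\le\mathcal N e^{-\nu(t-\tau)}$ for $\tau\le t$, $\tau\le0$. The associated Green function is: $G_A(t,\tau)=U(t,A)PU^{-1}(\tau,A)$ if $0\le\tau<t$; $G_A(t,\tau)=-U(t,A)(I-P)U^{-1}(\tau,A)$ if $t\le\tau$, $\tau\ge0$; $G_A(t,\tau)=-U(t,A)QU^{-1}(\tau,A)$ if $t\le\tau\le0$; $G_A(t,\tau)=U(t,A)(I-Q)U^{-1}(\tau,A)$ if $\tau\le t$, $\tau\le0$ (the cases overlap only for $\tau=0$ or $\tau=t$, which does not affect the integral). *)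

theory Defs
  imports "HOL-Analysis.Analysis"
begin

subsection \<open>Function spaces and Lagrange stability\<close>

text \<open>In both topologies the carrier (\<open>topspace\<close>) consists of the continuous functions only.\<close>

definition uniform_on_compacts_topology :: "('a::topological_space \<Rightarrow> 'b::metric_space) topology" where
  "uniform_on_compacts_topology = topology_generated_by
     {{g. continuous_on UNIV g \<and> (\<forall>t\<in>K. dist (g t) (f t) < e)} | f K e.
        continuous_on UNIV f \<and> compact K \<and> 0 < e}"

definition compact_open_topology :: "('a::topological_space \<Rightarrow> 'b::topological_space) topology" where
  "compact_open_topology = topology_generated_by
     {{g. continuous_on UNIV g \<and> g ` K \<subseteq> V} | K V. compact K \<and> open V}"

text \<open>Precompact means having compact closure in the ambient space.\<close>

definition precompact_in :: "'a topology \<Rightarrow> 'a set \<Rightarrow> bool" where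
  "precompact_in X S \<longleftrightarrow> S \<subseteq> topspace X \<and> compactin X (X closure_of S)"

definition Lagrange_stable :: "(real \<Rightarrow> 'b::metric_space) \<Rightarrow> bool" where
  "Lagrange_stable g \<longleftrightarrow>
     precompact_in uniform_on_compacts_topology (range (\<lambda>h t. g (t + h)))"

definition Lagrange_stable_param :: "(real \<times> 'a::topological_space \<Rightarrow> 'b::topological_space) \<Rightarrow> bool" where
  "Lagrange_stable_param F \<longleftrightarrow>
     precompact_in compact_open_topology (range (\<lambda>h (t, x). F (t + h, x)))"

subsection \<open>Two-sided remote almost periodicity\<close>

definition relatively_dense :: "real set \<Rightarrow> bool" where
  "relatively_dense S \<longleftrightarrow> (\<exists>l>0. \<forall>a. {a..a + l} \<inter> S \<noteq> {})"

text \<open>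
  The argument \<open>d s t\<close> is the distance between the values at \<open>t + s\<close> and at \<open>t\<close>: it is
  \<open>shift_dist g\<close> for a function \<open>g\<close> of time, and \<open>shift_dist_on K F\<close> for a function \<open>F\<close> of time
  and of a parameter in the compact set \<open>K\<close>.
\<close>

definition shift_dist :: "(real \<Rightarrow> 'b::metric_space) \<Rightarrow> real \<Rightarrow> real \<Rightarrow> real" where
  "shift_dist g s t = dist (g (t + s)) (g t)"

text \<open>
  The supremum is the intended one whenever \<open>K\<close> is nonempty and compact and \<open>F\<close> is continuous.
\<close>

definition shift_dist_on ::
  "'a set \<Rightarrow> (real \<times> 'a \<Rightarrow> 'b::real_normed_vector) \<Rightarrow> real \<Rightarrow> real \<Rightarrow> real" where
  "shift_dist_on K F s t = (SUP x\<in>K. norm (F (t + s, x) - F (t, x)))"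

definition remotely_almost_periodic :: "(real \<Rightarrow> real \<Rightarrow> real) \<Rightarrow> bool" where
  "remotely_almost_periodic d \<longleftrightarrow>
     (\<forall>\<epsilon>>0. \<exists>S. relatively_dense S \<and> (\<forall>s\<in>S. \<exists>l>0. \<forall>t. \<bar>t\<bar> \<ge> l \<longrightarrow> d s t < \<epsilon>))"

definition remotely_periodic :: "real \<Rightarrow> (real \<Rightarrow> real \<Rightarrow> real) \<Rightarrow> bool" where
  "remotely_periodic \<tau> d \<longleftrightarrow> (d \<tau> \<longlongrightarrow> 0) at_infinity"

definition remotely_stationary :: "(real \<Rightarrow> real \<Rightarrow> real) \<Rightarrow> bool" where
  "remotely_stationary d \<longleftrightarrow> (\<forall>s>0. remotely_periodic s d)"

subsection \<open>Linear equations and exponential trichotomy\<close>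

text \<open>
  For continuous \<open>A\<close> there is exactly one such \<open>U\<close>, and all its values are invertible.
\<close>

definition Cauchy_operator ::
  "(real \<Rightarrow> 'a::real_normed_vector \<Rightarrow>\<^sub>L 'a) \<Rightarrow> (real \<Rightarrow> 'a \<Rightarrow>\<^sub>L 'a) \<Rightarrow> bool" where
  "Cauchy_operator A U \<longleftrightarrow> U 0 = id_blinfun \<and>
     (\<forall>x t. ((\<lambda>t. blinfun_apply (U t) x) has_vector_derivative
        blinfun_apply (A t) (blinfun_apply (U t) x)) (at t))"

definition blinfun_inverse :: "('a::real_normed_vector \<Rightarrow>\<^sub>L 'b::real_normed_vector) \<Rightarrow> 'b \<Rightarrow>\<^sub>L 'a" where
  "blinfun_inverse T = (THE S. S o\<^sub>L T = id_blinfun \<and> T o\<^sub>L S = id_blinfun)"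

definition transported ::
  "(real \<Rightarrow> 'a::real_normed_vector \<Rightarrow>\<^sub>L 'a) \<Rightarrow> ('a \<Rightarrow>\<^sub>L 'a) \<Rightarrow> real \<Rightarrow> real \<Rightarrow> 'a \<Rightarrow>\<^sub>L 'a" where
  "transported U R t \<tau> = U t o\<^sub>L R o\<^sub>L blinfun_inverse (U \<tau>)"

definition exponential_trichotomy ::
  "(real \<Rightarrow> 'a::real_normed_vector \<Rightarrow>\<^sub>L 'a) \<Rightarrow> ('a \<Rightarrow>\<^sub>L 'a) \<Rightarrow> ('a \<Rightarrow>\<^sub>L 'a) \<Rightarrow> real \<Rightarrow> real \<Rightarrow> bool" where
  "exponential_trichotomy U P Q N \<nu> \<longleftrightarrow>
     N \<ge> 1 \<and> \<nu> > 0 \<and>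
     P o\<^sub>L P = P \<and> Q o\<^sub>L Q = Q \<and> P o\<^sub>L Q = Q o\<^sub>L P \<and> P + Q - (P o\<^sub>L Q) = id_blinfun \<and>
     (\<forall>t \<tau>. 0 \<le> \<tau> \<and> \<tau> \<le> t \<longrightarrow> norm (transported U P t \<tau>) \<le> N * exp (- \<nu> * (t - \<tau>))) \<and>
     (\<forall>t \<tau>. t \<le> \<tau> \<and> 0 \<le> \<tau> \<longrightarrow> norm (transported U (id_blinfun - P) t \<tau>) \<le> N * exp (- \<nu> * (\<tau> - t))) \<and>
     (\<forall>t \<tau>. t \<le> \<tau> \<and> \<tau> \<le> 0 \<longrightarrow> norm (transported U Q t \<tau>) \<le> N * exp (- \<nu> * (\<tau> - t))) \<and>
     (\<forall>t \<tau>. \<tau> \<le> t \<and> \<tau> \<le> 0 \<longrightarrow> norm (transported U (id_blinfun - Q) t \<tau>) \<le> N * exp (- \<nu> * (t - \<tau>)))"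

text \<open>
  The four cases of the Green function overlap only for \<open>\<tau> = 0\<close> or \<open>\<tau> = t\<close>, a null set of \<open>\<tau>\<close>;
  there the first applicable case is taken.
\<close>

definition Green_function ::
  "(real \<Rightarrow> 'a::real_normed_vector \<Rightarrow>\<^sub>L 'a) \<Rightarrow> ('a \<Rightarrow>\<^sub>L 'a) \<Rightarrow> ('a \<Rightarrow>\<^sub>L 'a) \<Rightarrow> real \<Rightarrow> real \<Rightarrow> 'a \<Rightarrow>\<^sub>L 'a" where
  "Green_function U P Q t \<tau> =
     (if 0 \<le> \<tau> \<and> \<tau> < t then transported U P t \<tau>
      else if t \<le> \<tau> \<and> 0 \<le> \<tau> then - transported U (id_blinfun - P) t \<tau>
      else if t \<le> \<tau> \<and> \<tau> \<le> 0 then - transported U Q t \<tau>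
      else transported U (id_blinfun - Q) t \<tau>)"

end

theory Submission
  imports Defs "HOL-Real_Asymp.Real_Asymp"
begin

text \<open>
  For a fixed shift \<open>s\<close> the difference \<open>\<psi> t = \<phi> (t + s) - \<phi> t\<close> is a bounded solution of
  \<open>\<psi>' = A \<psi> + r\<close>, and \<open>norm (r t) \<le> \<delta> + L * norm (\<psi> t)\<close> for large \<open>\<bar>t\<bar>\<close> as soon as \<open>s\<close> is a
  remote almost period of \<open>A\<close>, \<open>f\<close> and \<open>F\<close>. On each half-line the trichotomy is a dichotomy, and
  variation of constants bounds \<open>limsup norm \<psi>\<close> by \<open>2 * N / \<nu> * (\<delta> + L * limsup norm \<psi>)\<close>. As
  \<open>2 * N * L < \<nu>\<close>, this limsup is at most a fixed multiple of \<open>\<delta>\<close>, so remote almost periods of the data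
  are remote almost periods of \<open>\<phi>\<close>. Common almost periods of \<open>A\<close>, \<open>f\<close> and \<open>F\<close> are relatively
  dense because \<open>A\<close> and \<open>f\<close>, being Lagrange stable, are uniformly continuous.
\<close>

subsection \<open>Invertible operators\<close>

lemma blinfun_compose_eq_id_apply:
  assumes "S o\<^sub>L T = id_blinfun"
  shows "S (T x) = x"
  using arg_cong[OF assms, of "\<lambda>R. R x"] by simp

lemma blinfun_inverse_eqI:
  fixes T :: "'a::real_normed_vector \<Rightarrow>\<^sub>L 'b::real_normed_vector"
  assumes "S o\<^sub>L T = id_blinfun" "T o\<^sub>L S = id_blinfun"
  shows "blinfun_inverse T = S"
  unfolding blinfun_inverse_def
proof (rule the_equality)
  fix S' assume S': "S' o\<^sub>L T = id_blinfun \<and> T o\<^sub>L S' = id_blinfun"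
  show "S' = S"
  proof (rule blinfun_eqI)
    fix y
    have "S (T (S' y)) = S' y" "T (S' y) = y"
      using assms S' by (auto intro: blinfun_compose_eq_id_apply)
    then show "S' y = S y" by simp
  qed
qed (use assms in simp)

text \<open>Solving \<open>T x = y\<close> means finding a fixed point of
  \<open>x \<mapsto> y + x - T x\<close>, a contraction with factor 1/2, so Banach's theorem gives
  surjectivity. The lower bound \<open>norm x \<le> 2 * norm (T x)\<close> gives injectivity and the
  norm of the inverse.\<close>

lemma invertible_near_identity:
  fixes T :: "'a::banach \<Rightarrow>\<^sub>L 'a"
  assumes T: "norm (T - id_blinfun) \<le> 1 / 2"
  obtains S where "S o\<^sub>L T = id_blinfun" "T o\<^sub>L S = id_blinfun" "norm S \<le> 2"
proof -
  have near: "norm (x - T x) \<le> norm x / 2" for x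
  proof -
    have "norm (x - T x) = norm ((T - id_blinfun) x)"
      by (simp add: blinfun.diff_left norm_minus_commute)
    also have "\<dots> \<le> norm (T - id_blinfun) * norm x" by (rule norm_blinfun)
    also have "\<dots> \<le> 1 / 2 * norm x" by (intro mult_right_mono T norm_ge_zero)
    finally show ?thesis by simp
  qed
  have low: "norm x \<le> 2 * norm (T x)" for x
    using near[of x] norm_triangle_ineq2[of x "T x"] by linarith
  have inj: "x = y" if "T x = T y" for x y
    using low[of "x - y"] that by (simp add: blinfun.diff_right)
  have "\<exists>x. T x = y" for y
  proof -
    have "\<forall>u v. dist (y + u - T u) (y + v - T v) \<le> 1 / 2 * dist u v"
    proof (intro allI)
      fix u v
      have eq: "y + u - T u - (y + v - T v) = (u - v) - T (u - v)"
        by (simp add: blinfun.diff_right)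
      show "dist (y + u - T u) (y + v - T v) \<le> 1 / 2 * dist u v"
        unfolding dist_norm eq using near[of "u - v"] by simp
    qed
    from banach_fix_type[OF _ _ this] obtain x where "y + x - T x = x"
      by auto
    then show ?thesis by (intro exI[of _ x]) (simp add: algebra_simps)
  qed
  then obtain g where g: "T (g y) = y" for y by metis
  have "bounded_linear g"
  proof (rule bounded_linear_intro[where K = 2])
    show "g (x + y) = g x + g y" for x y
      by (rule inj) (simp add: g blinfun.add_right)
    show "g (r *\<^sub>R x) = r *\<^sub>R g x" for r x
      by (rule inj) (simp add: g blinfun.scaleR_right)
    show "norm (g x) \<le> norm x * 2" for x
      using low[of "g x"] by (simp add: g)
  qed
  then have ap: "blinfun_apply (Blinfun g) = g" by (rule bounded_linear_Blinfun_apply)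
  show ?thesis
  proof
    have "g (T x) = x" for x by (rule inj) (rule g)
    then show "Blinfun g o\<^sub>L T = id_blinfun" "T o\<^sub>L Blinfun g = id_blinfun"
      by (auto intro!: blinfun_eqI simp: ap g)
    show "norm (Blinfun g) \<le> 2"
      using low[of "g x" for x] by (intro norm_blinfun_bound) (simp_all add: ap g)
  qed
qed

text \<open>A product rule at a zero of \<open>w\<close>: the difference quotient of
  \<open>V s (w s)\<close> is \<open>V s\<close> applied to that of \<open>w\<close>, namely
  \<open>V s (q s) + V s r\<close> with \<open>q\<close> tending to 0. Local boundedness of
  \<open>V\<close> removes the first term, and strong continuity at \<open>r\<close> handles the
  second.\<close>

lemma has_vector_derivative_blinfun_null:
  fixes V :: "real \<Rightarrow> 'a::real_normed_vector \<Rightarrow>\<^sub>L 'b::real_normed_vector"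
  assumes w: "(w has_vector_derivative r) (at t)" and w0: "w t = 0"
    and bdd: "\<forall>\<^sub>F s in at t. norm (V s) \<le> K"
    and cont: "((\<lambda>s. V s r) \<longlongrightarrow> V t r) (at t)"
  shows "((\<lambda>s. V s (w s)) has_vector_derivative V t r) (at t)"
proof -
  define q where "q s = (1 / (s - t)) *\<^sub>R w s - r" for s
  have "((\<lambda>s. (1 / norm (s - t)) *\<^sub>R (w s - (s - t) *\<^sub>R r)) \<longlongrightarrow> 0) (at t)"
    using w w0 by (simp add: has_vector_derivative_def has_derivative_at2)
  then have "((\<lambda>s. norm ((1 / norm (s - t)) *\<^sub>R (w s - (s - t) *\<^sub>R r))) \<longlongrightarrow> 0) (at t)"
    by (rule tendsto_norm_zero)
  moreover have "norm (q s) = norm ((1 / norm (s - t)) *\<^sub>R (w s - (s - t) *\<^sub>R r))" if "s \<noteq> t" for s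
  proof -
    have "q s = (1 / (s - t)) *\<^sub>R (w s - (s - t) *\<^sub>R r)"
      using that by (simp add: q_def scaleR_diff_right)
    then show ?thesis by simp
  qed
  ultimately have "((\<lambda>s. norm (q s)) \<longlongrightarrow> 0) (at t)"
    by (subst tendsto_cong[of _ "\<lambda>s. norm ((1 / norm (s - t)) *\<^sub>R (w s - (s - t) *\<^sub>R r))"])
      (auto simp: eventually_at_filter)
  then have Kq: "((\<lambda>s. K * norm (q s)) \<longlongrightarrow> 0) (at t)"
    using tendsto_mult_right_zero by blast
  have Vq: "((\<lambda>s. V s (q s)) \<longlongrightarrow> 0) (at t)"
  proof (rule Lim_null_comparison[OF _ Kq])
    show "\<forall>\<^sub>F s in at t. norm (V s (q s)) \<le> K * norm (q s)"
      using bdd by eventually_elim (meson mult_right_mono norm_blinfun norm_ge_zero order_trans)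
  qed
  have "((\<lambda>s. V s (q s) + (V s r - V t r)) \<longlongrightarrow> 0 + (V t r - V t r)) (at t)"
    by (intro tendsto_intros Vq cont)
  then have "((\<lambda>s. norm (V s (q s) + (V s r - V t r))) \<longlongrightarrow> 0) (at t)"
    by (intro tendsto_norm_zero) simp
  moreover have "norm ((1 / norm (s - t)) *\<^sub>R (V s (w s) - (V t (w t) + (s - t) *\<^sub>R V t r)))
      = norm (V s (q s) + (V s r - V t r))" if "s \<noteq> t" for s
  proof -
    have "V s (q s) + (V s r - V t r) = (1 / (s - t)) *\<^sub>R (V s (w s) - (V t (w t) + (s - t) *\<^sub>R V t r))"
      using that w0 by (simp add: q_def blinfun.diff_right blinfun.scaleR_right scaleR_diff_right
          blinfun.zero_right)
    then show ?thesis by simp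
  qed
  ultimately have "((\<lambda>s. norm ((1 / norm (s - t)) *\<^sub>R (V s (w s) - (V t (w t) + (s - t) *\<^sub>R V t r)))) \<longlongrightarrow> 0) (at t)"
    by (subst tendsto_cong[of _ "\<lambda>s. norm (V s (q s) + (V s r - V t r))"])
      (auto simp: eventually_at_filter)
  then show ?thesis
    unfolding has_vector_derivative_def has_derivative_at2
    by (rule conjI[OF bounded_linear_scaleR_left tendsto_norm_zero_cancel])
qed

text \<open>The mean value inequality, with an antiderivative of the exponential bound as comparison
  function. Positive \<open>\<kappa>\<close> serves the stable part of a dichotomy, negative
  \<open>\<kappa>\<close> the unstable part.\<close>

lemma exponential_differentiable_bound:
  fixes g :: "real \<Rightarrow> 'a::real_normed_vector"
  assumes "a \<le> b" "\<kappa> \<noteq> 0"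
    and g: "\<And>s. a \<le> s \<Longrightarrow> s \<le> b \<Longrightarrow> (g has_vector_derivative g' s) (at s)"
    and g': "\<And>s. a \<le> s \<Longrightarrow> s \<le> b \<Longrightarrow> norm (g' s) \<le> c * exp (\<kappa> * (s - t))"
  shows "norm (g b - g a) \<le> c / \<kappa> * (exp (\<kappa> * (b - t)) - exp (\<kappa> * (a - t)))"
proof (cases "a = b")
  case False
  define \<Phi> where "\<Phi> s = c / \<kappa> * exp (\<kappa> * (s - t))" for s
  have \<Phi>: "(\<Phi> has_vector_derivative c * exp (\<kappa> * (s - t))) (at s)" for s
    unfolding \<Phi>_def has_real_derivative_iff_has_vector_derivative[symmetric]
    using \<open>\<kappa> \<noteq> 0\<close> by (auto intro!: derivative_eq_intros)
  have "norm (g b - g a) \<le> \<Phi> b - \<Phi> a"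
  proof (rule differentiable_bound_general[where f' = g'])
    show "continuous_on {a..b} g"
      by (intro continuous_at_imp_continuous_on ballI has_vector_derivative_continuous[OF g]) auto
    show "continuous_on {a..b} \<Phi>"
      by (intro continuous_at_imp_continuous_on ballI has_vector_derivative_continuous[OF \<Phi>])
  qed (use False assms \<Phi> in auto)
  then show ?thesis by (simp add: \<Phi>_def right_diff_distrib)
qed simp

subsection \<open>Linear equations with a dichotomy\<close>

locale linear_equation =
  fixes A U :: "real \<Rightarrow> 'a::banach \<Rightarrow>\<^sub>L 'a"
  assumes continuous: "continuous_on UNIV A"
    and Cauchy: "Cauchy_operator A U"
begin

abbreviation V :: "real \<Rightarrow> 'a \<Rightarrow>\<^sub>L 'a" where
  "V t \<equiv> blinfun_inverse (U t)"

section \<open>Invertibility of the Cauchy operator\<close>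

lemma U_0: "U 0 = id_blinfun"
  using Cauchy by (simp add: Cauchy_operator_def)

lemma U_deriv: "((\<lambda>t. U t x) has_vector_derivative A t (U t x)) (at t)"
  using Cauchy by (simp add: Cauchy_operator_def)

text \<open>Solutions move at speed at most \<open>a\<close> times their norm near
  \<open>t0\<close>. As the estimate is relative to \<open>norm (U u x)\<close>, one
  \<open>h\<close> works for all \<open>x\<close>, which turns information on single trajectories
  into operator norm information.\<close>

lemma U_short_time:
  obtains h where "h > 0"
    "\<And>t u x. t \<in> ball t0 h \<Longrightarrow> u \<in> ball t0 h \<Longrightarrow> norm (U t x - U u x) \<le> norm (U u x) / 2"
proof -
  define a where "a = norm (A t0) + 1"
  have a: "a > 0" by (simp add: a_def add_nonneg_pos)
  have "isCont A t0" using continuous by (simp add: continuous_on_eq_continuous_at)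
  then obtain d where d: "d > 0" "\<And>t. dist t t0 < d \<Longrightarrow> dist (A t) (A t0) < 1"
    unfolding continuous_at_eps_delta by (metis zero_less_one)
  \<comment> \<open>Two points of the ball are then at distance at most \<open>1 / (4 * a)\<close>,
    so a trajectory changes by at most a quarter of its maximal norm on the segment between
    them.\<close>
  define h where "h = min d (1 / (8 * a))"
  have Aa: "norm (A t) \<le> a" if "t \<in> ball t0 h" for t
    using d(2)[of t] that norm_triangle_ineq2[of "A t" "A t0"]
    by (simp add: h_def a_def dist_commute[of t0] dist_norm[of "A t"])
  show ?thesis
  proof
    show "h > 0" using a d by (simp add: h_def)
    fix t u x assume tu: "t \<in> ball t0 h" "u \<in> ball t0 h"
    define J where "J = closed_segment u t"
    have J: "J \<subseteq> ball t0 h" "convex J" "u \<in> J" "t \<in> J" "compact J"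
      using tu by (auto simp: J_def closed_segment_subset)
    have "continuous_on J (\<lambda>s. norm (U s x))"
      by (intro continuous_on_norm continuous_at_imp_continuous_on ballI
          has_vector_derivative_continuous[OF U_deriv])
    then obtain s where s: "s \<in> J" "\<And>v. v \<in> J \<Longrightarrow> norm (U v x) \<le> norm (U s x)"
      using continuous_attains_sup[of J "\<lambda>s. norm (U s x)"] J by blast
    have diff: "norm (U v x - U u x) \<le> norm (U s x) / 4" if v: "v \<in> J" for v
    proof -
      have "norm (U v x - U u x) \<le> (a * norm (U s x)) * norm (v - u)"
      proof (rule differentiable_bound[OF J(2) _ _ v J(3)])
        fix w assume w: "w \<in> J"
        show "((\<lambda>t. U t x) has_derivative (\<lambda>h. h *\<^sub>R A w (U w x))) (at w within J)"
          using U_deriv[of x w] by (simp add: has_vector_derivative_def has_derivative_at_withinI)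
        have "norm (A w (U w x)) \<le> norm (A w) * norm (U w x)" by (rule norm_blinfun)
        also have "\<dots> \<le> a * norm (U s x)"
          using Aa J(1) w s(2)[OF w] a by (intro mult_mono) auto
        finally show "onorm (\<lambda>h. h *\<^sub>R A w (U w x)) \<le> a * norm (U s x)"
          by (intro onorm_le) (simp add: mult_left_mono mult.commute)
      qed
      also have "\<dots> \<le> (a * norm (U s x)) * (1 / (4 * a))"
      proof (rule mult_left_mono)
        have "norm (v - u) \<le> dist t0 v + dist t0 u"
          using dist_triangle3[of v u t0] by (simp add: dist_norm)
        also have "\<dots> \<le> 1 / (8 * a) + 1 / (8 * a)"
          using J(1) v tu by (intro add_mono) (auto simp: h_def)
        finally show "norm (v - u) \<le> 1 / (4 * a)" by simp
      qed (use a in simp)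
      finally show ?thesis using a by simp
    qed
    \<comment> \<open>The maximum is thus at most 4/3 of \<open>norm (U u x)\<close>, and a quarter
      of it is at most 1/3, hence below the claimed 1/2.\<close>
    have "norm (U s x) \<le> norm (U u x) + norm (U s x) / 4"
      using diff[OF s(1)] norm_triangle_ineq2[of "U s x" "U u x"] by linarith
    then show "norm (U t x - U u x) \<le> norm (U u x) / 2"
      using diff[OF J(4)] norm_ge_zero[of "U u x"] by linarith
  qed
qed

text \<open>The operator \<open>U t o\<^sub>L S\<close> is within 1/2 of the identity, so it has an
  inverse \<open>W\<close> of norm at most 2, and \<open>S o\<^sub>L W\<close> inverts
  \<open>U t\<close>.\<close>

lemma U_inverse_step:
  assumes S: "S o\<^sub>L U u = id_blinfun" "U u o\<^sub>L S = id_blinfun"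
    and close: "\<And>x. norm (U t x - U u x) \<le> norm (U u x) / 2"
  obtains R where "R o\<^sub>L U t = id_blinfun" "U t o\<^sub>L R = id_blinfun" "norm R \<le> 2 * norm S"
proof -
  have S': "S (U u x) = x" "U u (S x) = x" for x
    using S by (auto intro: blinfun_compose_eq_id_apply)
  have "norm ((U t o\<^sub>L S) - id_blinfun) \<le> 1 / 2"
  proof (rule norm_blinfun_bound)
    show "norm (((U t o\<^sub>L S) - id_blinfun) x) \<le> 1 / 2 * norm x" for x
      using close[of "S x"] by (simp add: blinfun.diff_left S')
  qed simp
  then obtain W where W: "W o\<^sub>L (U t o\<^sub>L S) = id_blinfun" "(U t o\<^sub>L S) o\<^sub>L W = id_blinfun" "norm W \<le> 2"
    using invertible_near_identity by blast
  have W': "W (U t (S x)) = x" "U t (S (W x)) = x" for x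
    using blinfun_compose_eq_id_apply[OF W(1)] blinfun_compose_eq_id_apply[OF W(2)] by simp_all
  show ?thesis
  proof
    have "S (W (U t x)) = x" for x
      using W'(1)[of "U u x"] by (simp add: S')
    then show "(S o\<^sub>L W) o\<^sub>L U t = id_blinfun" by (auto intro!: blinfun_eqI)
    show "U t o\<^sub>L (S o\<^sub>L W) = id_blinfun" by (auto intro!: blinfun_eqI simp: W')
    have "norm (S o\<^sub>L W) \<le> norm S * norm W" by (rule norm_blinfun_compose)
    also have "\<dots> \<le> norm S * 2" by (intro mult_left_mono W norm_ge_zero)
    finally show "norm (S o\<^sub>L W) \<le> 2 * norm S" by simp
  qed
qed

text \<open>Invertibility spreads from time 0 over the connected real line, since near each point it
  passes from any time to any other. This ensures that the description operator in
  \<open>blinfun_inverse\<close> denotes a two-sided inverse.\<close>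

lemma U_invertible: "V t o\<^sub>L U t = id_blinfun" "U t o\<^sub>L V t = id_blinfun"
proof -
  have "\<exists>S. S o\<^sub>L U t = id_blinfun \<and> U t o\<^sub>L S = id_blinfun"
  proof (rule connected_induction_simple[of UNIV 0 t])
    show "\<exists>S. S o\<^sub>L U 0 = id_blinfun \<and> U 0 o\<^sub>L S = id_blinfun"
      by (intro exI[of _ id_blinfun]) (auto simp: U_0 intro!: blinfun_eqI)
    fix t0 :: real
    obtain h where h: "h > 0"
      "\<And>t u x. t \<in> ball t0 h \<Longrightarrow> u \<in> ball t0 h \<Longrightarrow> norm (U t x - U u x) \<le> norm (U u x) / 2"
      using U_short_time by blast
    show "\<exists>T. openin (top_of_set UNIV) T \<and> t0 \<in> T \<and> (\<forall>u\<in>T. \<forall>t\<in>T.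
        (\<exists>S. S o\<^sub>L U u = id_blinfun \<and> U u o\<^sub>L S = id_blinfun) \<longrightarrow>
        (\<exists>S. S o\<^sub>L U t = id_blinfun \<and> U t o\<^sub>L S = id_blinfun))"
    proof (intro exI[of _ "ball t0 h"] conjI ballI impI)
      fix u t assume ut: "u \<in> ball t0 h" "t \<in> ball t0 h"
        and "\<exists>S. S o\<^sub>L U u = id_blinfun \<and> U u o\<^sub>L S = id_blinfun"
      then obtain S where S: "S o\<^sub>L U u = id_blinfun" "U u o\<^sub>L S = id_blinfun" by blast
      show "\<exists>S. S o\<^sub>L U t = id_blinfun \<and> U t o\<^sub>L S = id_blinfun"
        by (rule U_inverse_step[OF S h(2)[OF ut(2,1)]]) blast
    qed (use h in auto)
  qed auto
  then obtain S where "S o\<^sub>L U t = id_blinfun" "U t o\<^sub>L S = id_blinfun" by blast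
  then show "V t o\<^sub>L U t = id_blinfun" "U t o\<^sub>L V t = id_blinfun"
    by (simp_all add: blinfun_inverse_eqI)
qed

lemma U_V [simp]: "U t (V t x) = x" and V_U [simp]: "V t (U t x) = x"
  using U_invertible by (auto intro: blinfun_compose_eq_id_apply)

section \<open>Regularity of the inverse and variation of constants\<close>

lemma V_locally_bounded: "\<forall>\<^sub>F t in at t0. norm (V t) \<le> 2 * norm (V t0)"
proof -
  obtain h where h: "h > 0"
    "\<And>t u x. t \<in> ball t0 h \<Longrightarrow> u \<in> ball t0 h \<Longrightarrow> norm (U t x - U u x) \<le> norm (U u x) / 2"
    using U_short_time by blast
  have "norm (V t) \<le> 2 * norm (V t0)" if "t \<in> ball t0 h" for t
  proof (rule U_inverse_step[OF U_invertible h(2)[OF that]])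
    show "t0 \<in> ball t0 h" using h(1) by simp
    show "norm (V t) \<le> 2 * norm (V t0)"
      if "R o\<^sub>L U t = id_blinfun" "U t o\<^sub>L R = id_blinfun" "norm R \<le> 2 * norm (V t0)" for R
      using that blinfun_inverse_eqI by blast
  qed
  then show ?thesis
    unfolding eventually_at using h(1) by (metis dist_commute mem_ball)
qed

text \<open>With \<open>y = V t0 x\<close>, the identity
  \<open>V t x - V t0 x = V t (U t0 y - U t y)\<close> reduces the claim to continuity of one
  trajectory of \<open>U\<close> and local boundedness of \<open>V\<close>.\<close>

lemma V_strongly_continuous: "((\<lambda>t. V t x) \<longlongrightarrow> V t0 x) (at t0)"
proof -
  define y where "y = V t0 x"
  have "((\<lambda>t. U t y) \<longlongrightarrow> U t0 y) (at t0)"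
    using has_vector_derivative_continuous[OF U_deriv[of y t0]] by (simp only: continuous_within)
  then have "((\<lambda>t. 2 * norm (V t0) * norm (U t0 y - U t y)) \<longlongrightarrow> 2 * norm (V t0) * norm (U t0 y - U t0 y)) (at t0)"
    by (intro tendsto_mult_left tendsto_norm tendsto_diff tendsto_const)
  then have lim: "((\<lambda>t. 2 * norm (V t0) * norm (U t0 y - U t y)) \<longlongrightarrow> 0) (at t0)"
    by simp
  have "((\<lambda>t. V t x - V t0 x) \<longlongrightarrow> 0) (at t0)"
  proof (rule Lim_null_comparison[OF _ lim])
    show "\<forall>\<^sub>F t in at t0. norm (V t x - V t0 x) \<le> 2 * norm (V t0) * norm (U t0 y - U t y)"
      using V_locally_bounded
    proof eventually_elim
      case (elim t)
      have "V t x - V t0 x = V t (U t0 y - U t y)"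
        by (simp add: y_def blinfun.diff_right)
      also have "norm \<dots> \<le> norm (V t) * norm (U t0 y - U t y)" by (rule norm_blinfun)
      also have "\<dots> \<le> 2 * norm (V t0) * norm (U t0 y - U t y)"
        using elim by (intro mult_right_mono) auto
      finally show ?case .
    qed
  qed
  then show ?thesis by (simp add: LIM_zero_iff)
qed

text \<open>Subtracting the homogeneous solution through \<open>\<psi> t\<close> leaves a function
  \<open>w\<close> that vanishes at \<open>t\<close> with derivative \<open>r\<close>. Since
  \<open>V s\<close> maps that homogeneous solution to a constant, the product rule at a zero
  applies.\<close>

lemma variation_of_constants:
  assumes "(\<psi> has_vector_derivative A t (\<psi> t) + r) (at t)"
  shows "((\<lambda>s. V s (\<psi> s)) has_vector_derivative V t r) (at t)"
proof -
  define w where "w s = \<psi> s - U s (V t (\<psi> t))" for s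
  have "(w has_vector_derivative (A t (\<psi> t) + r - A t (U t (V t (\<psi> t))))) (at t)"
    unfolding w_def by (intro has_vector_derivative_diff assms U_deriv)
  moreover have w0: "w t = 0" by (simp add: w_def)
  ultimately have "((\<lambda>s. V s (w s)) has_vector_derivative V t r) (at t)"
    using V_locally_bounded V_strongly_continuous
    by (intro has_vector_derivative_blinfun_null) simp_all
  then have "((\<lambda>s. V s (w s) + V t (\<psi> t)) has_vector_derivative (V t r + 0)) (at t)"
    by (intro has_vector_derivative_add has_vector_derivative_const)
  then show ?thesis by (simp add: w_def blinfun.diff_right)
qed

section \<open>Bounded solutions on a half-line with a dichotomy\<close>

lemma transported_apply: "transported U R t \<tau> x = U t (R (V \<tau> x))"
  by (simp add: transported_def)

text \<open>The \<open>P\<close> part of \<open>\<psi> t\<close> is estimated from the past,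
  starting at \<open>l\<close>, and the complementary part from the future. The forcing contributes
  at most \<open>N * \<rho> / \<nu>\<close> to each.\<close>

lemma dichotomy_bound:
  assumes stable: "\<And>t \<tau>. 0 \<le> \<tau> \<Longrightarrow> \<tau> \<le> t \<Longrightarrow>
      norm (transported U P t \<tau>) \<le> N * exp (- \<nu> * (t - \<tau>))"
    and unstable: "\<And>t \<tau>. 0 \<le> \<tau> \<Longrightarrow> t \<le> \<tau> \<Longrightarrow>
      norm (transported U (id_blinfun - P) t \<tau>) \<le> N * exp (- \<nu> * (\<tau> - t))"
    and \<nu>: "\<nu> > 0" and l: "0 \<le> l" "l \<le> t"
    and \<psi>: "\<And>s. l \<le> s \<Longrightarrow> (\<psi> has_vector_derivative A s (\<psi> s) + r s) (at s)"
    and M: "\<And>s. l \<le> s \<Longrightarrow> norm (\<psi> s) \<le> M"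
    and \<rho>: "\<And>s. l \<le> s \<Longrightarrow> norm (r s) \<le> \<rho>"
  shows "norm (\<psi> t) \<le> N * M * exp (- \<nu> * (t - l)) + 2 * N * \<rho> / \<nu>"
proof -
  \<comment> \<open>The value at time \<open>s\<close> carried to the fixed time \<open>t\<close>
    through \<open>R\<close>. Only \<open>V s (\<psi> s)\<close> varies with \<open>s\<close>, so
    the derivative is the transported forcing.\<close>
  define g where "g R s = U t (R (V s (\<psi> s)))" for R :: "'a \<Rightarrow>\<^sub>L 'a" and s
  have g_eq: "g R s = transported U R t s (\<psi> s)" for R s
    by (simp add: g_def transported_apply)
  have g_deriv: "(g R has_vector_derivative transported U R t s (r s)) (at s)" if "l \<le> s" for R s
  proof -
    have "bounded_linear (\<lambda>x. U t (R x))"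
      by (intro bounded_linear_compose[OF blinfun.bounded_linear_right blinfun.bounded_linear_right])
    from bounded_linear.has_vector_derivative[OF this variation_of_constants[OF \<psi>[OF that]]]
    show ?thesis by (simp add: g_def[abs_def] transported_apply)
  qed
  have apply_bound: "norm (transported U R t s y) \<le> N * K * e"
    if "norm (transported U R t s) \<le> N * e" "norm y \<le> K" for R s y K e
  proof -
    have "norm (transported U R t s y) \<le> norm (transported U R t s) * norm y"
      by (rule norm_blinfun)
    also have "\<dots> \<le> (N * e) * K"
      using that by (intro mult_mono) (auto intro: order_trans[OF norm_ge_zero])
    finally show ?thesis by (simp add: mult_ac)
  qed
  have N: "0 \<le> N"
    using order_trans[OF norm_ge_zero stable[of 0 0]] by simp
  have \<rho>0: "0 \<le> \<rho>" using order_trans[OF norm_ge_zero \<rho>[OF l(2)]] .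
  have "norm (g P t - g P l) \<le> N * \<rho> / \<nu> * (exp (\<nu> * (t - t)) - exp (\<nu> * (l - t)))"
  proof (rule exponential_differentiable_bound[OF l(2) _ g_deriv])
    fix s assume "l \<le> s" "s \<le> t"
    then show "norm (transported U P t s (r s)) \<le> N * \<rho> * exp (\<nu> * (s - t))"
      using stable[of s t] l \<rho> by (intro apply_bound) (auto simp: algebra_simps)
  qed (use \<nu> in auto)
  also have "\<dots> \<le> N * \<rho> / \<nu> * 1"
    using N \<rho>0 \<nu> by (intro mult_left_mono) auto
  finally have "norm (g P t - g P l) \<le> N * \<rho> / \<nu>" by simp
  moreover have "norm (g P l) \<le> N * M * exp (- \<nu> * (t - l))"
    unfolding g_eq using stable l M by (intro apply_bound) auto
  ultimately have P: "norm (g P t) \<le> N * M * exp (- \<nu> * (t - l)) + N * \<rho> / \<nu>"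
    using norm_triangle_sub[of "g P t" "g P l"] by linarith
  define R where "R = id_blinfun - P"
  have R: "norm (g R t) \<le> N * M * exp (- \<nu> * (T - t)) + N * \<rho> / \<nu>" if "t \<le> T" for T
  proof -
    have "norm (g R T - g R t) \<le> N * \<rho> / - \<nu> * (exp (- \<nu> * (T - t)) - exp (- \<nu> * (t - t)))"
    proof (rule exponential_differentiable_bound[OF that _ g_deriv])
      fix s assume "t \<le> s" "s \<le> T"
      then show "norm (transported U R t s (r s)) \<le> N * \<rho> * exp (- \<nu> * (s - t))"
        using unstable[of s t] l \<rho> by (intro apply_bound) (auto simp: R_def)
    qed (use \<nu> l in auto)
    also have "\<dots> = N * \<rho> / \<nu> * (1 - exp (- \<nu> * (T - t)))"
      using \<nu> by (simp add: field_simps)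
    also have "\<dots> \<le> N * \<rho> / \<nu> * 1"
      using N \<rho>0 \<nu> by (intro mult_left_mono) auto
    finally have "norm (g R T - g R t) \<le> N * \<rho> / \<nu>" by simp
    moreover have "norm (g R T) \<le> N * M * exp (- \<nu> * (T - t))"
      unfolding g_eq using unstable[of T t] l M that by (intro apply_bound) (auto simp: R_def)
    ultimately show ?thesis
      using norm_triangle_sub[of "g R t" "g R T"] norm_minus_commute[of "g R t" "g R T"] by linarith
  qed
  \<comment> \<open>The boundary term at \<open>T\<close> vanishes in the limit because
    \<open>\<psi>\<close> is bounded.\<close>
  have "((\<lambda>T. N * M * exp (- \<nu> * (T - t)) + N * \<rho> / \<nu>) \<longlongrightarrow> N * \<rho> / \<nu>) at_top"
    using \<nu> by real_asymp
  then have "norm (g R t) \<le> N * \<rho> / \<nu>"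
    by (rule tendsto_lowerbound) (use R in \<open>auto intro!: eventually_at_top_linorderI[of t]\<close>)
  moreover have "\<psi> t = g P t + g R t"
    by (simp add: g_def R_def blinfun.diff_left blinfun.diff_right)
  ultimately show ?thesis
    using P norm_triangle_ineq[of "g P t" "g R t"] by simp
qed

text \<open>An eventual bound \<open>b\<close> for \<open>\<psi>\<close> improves to
  \<open>2 * N * (\<delta> + L * b) / \<nu>\<close> up to any \<open>e > 0\<close>. At the infimum
  of such bounds this becomes an inequality that can be solved for it because
  \<open>2 * N * L < \<nu>\<close>.\<close>

lemma dichotomy_asymptotic_bound:
  assumes stable: "\<And>t \<tau>. 0 \<le> \<tau> \<Longrightarrow> \<tau> \<le> t \<Longrightarrow>
      norm (transported U P t \<tau>) \<le> N * exp (- \<nu> * (t - \<tau>))"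
    and unstable: "\<And>t \<tau>. 0 \<le> \<tau> \<Longrightarrow> t \<le> \<tau> \<Longrightarrow>
      norm (transported U (id_blinfun - P) t \<tau>) \<le> N * exp (- \<nu> * (\<tau> - t))"
    and N: "N > 0" and L: "0 \<le> L" "2 * N * L < \<nu>"
    and \<psi>: "\<And>s. (\<psi> has_vector_derivative A s (\<psi> s) + r s) (at s)"
    and M: "\<And>s. norm (\<psi> s) \<le> M"
    and r: "\<forall>\<^sub>F s in at_top. norm (r s) \<le> \<delta> + L * norm (\<psi> s)"
    and m: "2 * N * \<delta> / (\<nu> - 2 * N * L) < m"
  shows "\<forall>\<^sub>F s in at_top. norm (\<psi> s) \<le> m"
proof -
  \<comment> \<open>The infimum of \<open>B\<close> is \<open>limsup norm \<psi>\<close>.\<close>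
  define B where "B = {b. \<forall>\<^sub>F s in at_top. norm (\<psi> s) \<le> b}"
  have \<nu>: "\<nu> > 0" using L N by (meson less_imp_le mult_nonneg_nonneg order_le_less_trans zero_le_numeral)
  have step: "2 * N * (\<delta> + L * b) / \<nu> + e \<in> B" if b: "b \<in> B" and e: "e > 0" for b e
  proof -
    have "\<forall>\<^sub>F s in at_top. norm (r s) \<le> \<delta> + L * b"
      using r b[unfolded B_def mem_Collect_eq]
    proof eventually_elim
      case (elim s)
      then show ?case using mult_left_mono[OF elim(2) L(1)] by linarith
    qed
    then obtain l0 where l0: "\<And>s. l0 \<le> s \<Longrightarrow> norm (r s) \<le> \<delta> + L * b"
      unfolding eventually_at_top_linorder by blast
    \<comment> \<open>The estimate restarts at a time in the half-line of the dichotomy after which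
      the forcing is at most \<open>\<delta> + L * b\<close>; the term with the global bound
      \<open>M\<close> then decays below \<open>e\<close>.\<close>
    define l where "l = max 0 l0"
    have "((\<lambda>t. N * M * exp (- \<nu> * (t - l))) \<longlongrightarrow> 0) at_top"
      using \<nu> by real_asymp
    then have "\<forall>\<^sub>F t in at_top. N * M * exp (- \<nu> * (t - l)) < e"
      using e by (rule order_tendstoD)
    then show ?thesis
      unfolding B_def mem_Collect_eq using eventually_ge_at_top[of l]
    proof eventually_elim
      case (elim t)
      have "norm (\<psi> t) \<le> N * M * exp (- \<nu> * (t - l)) + 2 * N * (\<delta> + L * b) / \<nu>"
        using elim l0 by (intro dichotomy_bound[OF stable unstable \<nu> _ _ \<psi> M]) (auto simp: l_def)
      then show ?case using elim by linarith
    qed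
  qed
  have "M \<in> B" using M by (simp add: B_def)
  have B0: "0 \<le> b" if "b \<in> B" for b
  proof -
    from that obtain s where "norm (\<psi> s) \<le> b"
      unfolding B_def eventually_at_top_linorder by blast
    then show ?thesis by (rule order_trans[OF norm_ge_zero])
  qed
  then have bdd: "bdd_below B" by (rule bdd_belowI)
  define m0 where "m0 = Inf B"
  have m0: "m0 \<le> 2 * N * (\<delta> + L * b) / \<nu>" if "b \<in> B" for b
    unfolding m0_def
    by (rule field_le_epsilon) (intro cInf_lower bdd step that)
  \<comment> \<open>The bound for every \<open>b\<close> in \<open>B\<close> passes to the infimum.
    Isolating \<open>b\<close> divides by \<open>L\<close>, hence the separate case
    \<open>L = 0\<close>.\<close>
  have "m0 * \<nu> / (2 * N) - \<delta> \<le> L * m0"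
  proof (cases "L = 0")
    case True
    then show ?thesis using m0[OF \<open>M \<in> B\<close>] \<nu> N by (simp add: field_simps)
  next
    case False
    have "(m0 * \<nu> / (2 * N) - \<delta>) / L \<le> b" if "b \<in> B" for b
      using m0[OF that] False L \<nu> N by (simp add: field_simps)
    then have "(m0 * \<nu> / (2 * N) - \<delta>) / L \<le> m0"
      unfolding m0_def using \<open>M \<in> B\<close> by (intro cInf_greatest) (auto simp: m0_def)
    then show ?thesis using False L by (simp add: field_simps)
  qed
  then have "m0 \<le> 2 * N * \<delta> / (\<nu> - 2 * N * L)"
    using L N by (simp add: field_simps)
  then have "Inf B < m" using m by (simp add: m0_def)
  then obtain b where "b \<in> B" "b < m"
    using cInf_lessD \<open>M \<in> B\<close> by blast
  then show ?thesis
    unfolding B_def by (auto elim: eventually_mono)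
qed

section \<open>Time reversal and both half-lines together\<close>

lemma reflected: "linear_equation (\<lambda>t. - A (- t)) (\<lambda>t. U (- t))"
proof
  show "continuous_on UNIV (\<lambda>t. - A (- t))"
    by (intro continuous_intros continuous_on_compose2[OF continuous]) auto
  show "Cauchy_operator (\<lambda>t. - A (- t)) (\<lambda>t. U (- t))"
    unfolding Cauchy_operator_def
  proof (intro conjI allI)
    fix x t
    have "((\<lambda>t. U (- t) x) has_vector_derivative (- 1) *\<^sub>R A (- t) (U (- t) x)) (at t)"
      by (rule vector_diff_chain_at[of uminus "- 1" t "\<lambda>t. U t x", unfolded o_def])
        (auto intro!: derivative_eq_intros U_deriv)
    then show "((\<lambda>t. U (- t) x) has_vector_derivative (- A (- t)) (U (- t) x)) (at t)"
      by (simp add: blinfun.minus_left)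
  qed (simp add: U_0)
qed

lemma trichotomy_asymptotic_bound:
  assumes tri: "exponential_trichotomy U P Q N \<nu>"
    and L: "0 \<le> L" "L < \<nu> / (2 * N)"
    and \<psi>: "\<And>s. (\<psi> has_vector_derivative A s (\<psi> s) + r s) (at s)"
    and M: "\<And>s. norm (\<psi> s) \<le> M"
    and r: "\<forall>\<^sub>F s in at_infinity. norm (r s) \<le> \<delta> + L * norm (\<psi> s)"
    and m: "2 * N * \<delta> / (\<nu> - 2 * N * L) < m"
  shows "\<forall>\<^sub>F s in at_infinity. norm (\<psi> s) \<le> m"
proof -
  have N: "N > 0" using tri by (simp add: exponential_trichotomy_def)
  have L': "2 * N * L < \<nu>" using L N by (simp add: field_simps)
  have r_top: "\<forall>\<^sub>F s in at_top. norm (r s) \<le> \<delta> + L * norm (\<psi> s)"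
    and r_bot: "\<forall>\<^sub>F s in at_top. norm (- r (- s)) \<le> \<delta> + L * norm (\<psi> (- s))"
    using r by (simp_all add: at_infinity_eq_at_top_bot eventually_sup at_bot_mirror eventually_filtermap)
  have top: "\<forall>\<^sub>F s in at_top. norm (\<psi> s) \<le> m"
    using tri by (intro dichotomy_asymptotic_bound[OF _ _ N L(1) L' \<psi> M r_top m])
      (auto simp: exponential_trichotomy_def)
  have Q: "norm (transported U Q t \<tau>) \<le> N * exp (- \<nu> * (\<tau> - t))" if "t \<le> \<tau>" "\<tau> \<le> 0" for t \<tau>
    using tri that by (simp add: exponential_trichotomy_def)
  have IQ: "norm (transported U (id_blinfun - Q) t \<tau>) \<le> N * exp (- \<nu> * (t - \<tau>))"
    if "\<tau> \<le> t" "\<tau> \<le> 0" for t \<tau>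
    using tri that by (simp add: exponential_trichotomy_def)
  \<comment> \<open>\<open>Q\<close> decays backwards in time on the negative half-line, so after
    reversal it is the stable projection there. The forcing becomes
    \<open>- r (- s)\<close>.\<close>
  have "\<forall>\<^sub>F s in at_top. norm (\<psi> (- s)) \<le> m"
  proof (rule linear_equation.dichotomy_asymptotic_bound[OF reflected _ _ N L(1) L' _ M r_bot m])
    have eq: "transported (\<lambda>t. U (- t)) R t \<tau> = transported U R (- t) (- \<tau>)" for R t \<tau>
      by (simp add: transported_def)
    fix t \<tau> :: real assume \<tau>: "0 \<le> \<tau>"
    show "norm (transported (\<lambda>t. U (- t)) Q t \<tau>) \<le> N * exp (- \<nu> * (t - \<tau>))" if "\<tau> \<le> t"
      using Q[of "- t" "- \<tau>"] \<tau> that by (simp add: eq)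
    show "norm (transported (\<lambda>t. U (- t)) (id_blinfun - Q) t \<tau>) \<le> N * exp (- \<nu> * (\<tau> - t))" if "t \<le> \<tau>"
      using IQ[of "- \<tau>" "- t"] \<tau> that by (simp add: eq)
  next
    fix s
    have "((\<lambda>s. \<psi> (- s)) has_vector_derivative (- 1) *\<^sub>R (A (- s) (\<psi> (- s)) + r (- s))) (at s)"
      by (rule vector_diff_chain_at[of uminus "- 1" s \<psi>, unfolded o_def])
        (auto intro!: derivative_eq_intros \<psi>)
    then show "((\<lambda>s. \<psi> (- s)) has_vector_derivative (- A (- s)) (\<psi> (- s)) + - r (- s)) (at s)"
      by (simp add: blinfun.minus_left)
  qed
  with top show ?thesis
    by (simp add: at_infinity_eq_at_top_bot eventually_sup at_bot_mirror eventually_filtermap)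
qed

text \<open>The quantifier over \<open>u\<close> in the assumption on \<open>F\<close> makes the
  shift error uniform along the range of \<open>\<phi>\<close>, so it may be evaluated at the moving
  point \<open>\<phi> (t + s)\<close>.\<close>

lemma solution_shift_bound:
  assumes tri: "exponential_trichotomy U P Q N \<nu>"
    and L: "0 \<le> L" "L < \<nu> / (2 * N)"
    and lip: "\<And>t x y. norm (F (t, x) - F (t, y)) \<le> L * norm (x - y)"
    and \<phi>: "\<And>t. (\<phi> has_vector_derivative A t (\<phi> t) + f t + F (t, \<phi> t)) (at t)"
    and M: "\<And>t. norm (\<phi> t) \<le> M"
    and \<delta>: "\<delta> > 0"
    and shift_A: "\<forall>\<^sub>F t in at_infinity. norm (A (t + s) - A t) < \<delta>"
    and shift_f: "\<forall>\<^sub>F t in at_infinity. norm (f (t + s) - f t) < \<delta>"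
    and shift_F: "\<forall>\<^sub>F t in at_infinity. \<forall>u. norm (F (t + s, \<phi> u) - F (t, \<phi> u)) < \<delta>"
  shows "\<forall>\<^sub>F t in at_infinity. norm (\<phi> (t + s) - \<phi> t) < (2 * N * (M + 2) / (\<nu> - 2 * N * L) + 2) * \<delta>"
proof -
  define \<psi> where "\<psi> t = \<phi> (t + s) - \<phi> t" for t
  \<comment> \<open>The first three summands are eventually bounded by \<open>\<delta> * M\<close>,
    \<open>\<delta>\<close> and \<open>\<delta>\<close>; the Lipschitz condition bounds the last one
    by \<open>L * norm (\<psi> t)\<close>.\<close>
  define r where "r t = (A (t + s) - A t) (\<phi> (t + s)) + (f (t + s) - f t)
    + (F (t + s, \<phi> (t + s)) - F (t, \<phi> (t + s))) + (F (t, \<phi> (t + s)) - F (t, \<phi> t))" for t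
  have "(\<psi> has_vector_derivative A t (\<psi> t) + r t) (at t)" for t
  proof -
    have "((\<lambda>t. \<phi> (t + s)) has_vector_derivative
        1 *\<^sub>R (A (t + s) (\<phi> (t + s)) + f (t + s) + F (t + s, \<phi> (t + s)))) (at t)"
      by (rule vector_diff_chain_at[of "\<lambda>t. t + s" 1 t \<phi>, unfolded o_def])
        (auto intro!: derivative_eq_intros \<phi>)
    from has_vector_derivative_diff[OF this \<phi>] show ?thesis
      by (simp add: \<psi>_def[abs_def] r_def blinfun.diff_left blinfun.diff_right algebra_simps)
  qed
  moreover have "norm (\<psi> t) \<le> 2 * M" for t
    using norm_triangle_ineq4[of "\<phi> (t + s)" "\<phi> t"] M[of t] M[of "t + s"]
    unfolding \<psi>_def by linarith
  moreover have "\<forall>\<^sub>F t in at_infinity. norm (r t) \<le> (M + 2) * \<delta> + L * norm (\<psi> t)"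
    using shift_A shift_f shift_F
  proof eventually_elim
    case (elim t)
    have "norm ((A (t + s) - A t) (\<phi> (t + s))) \<le> norm (A (t + s) - A t) * norm (\<phi> (t + s))"
      by (rule norm_blinfun)
    also have "\<dots> \<le> \<delta> * M"
      using elim(1) M \<delta> by (intro mult_mono) auto
    finally have 1: "norm ((A (t + s) - A t) (\<phi> (t + s))) \<le> \<delta> * M" .
    have 2: "norm (F (t + s, \<phi> (t + s)) - F (t, \<phi> (t + s))) < \<delta>" using elim(3) by blast
    have 3: "norm (F (t, \<phi> (t + s)) - F (t, \<phi> t)) \<le> L * norm (\<psi> t)"
      unfolding \<psi>_def by (rule lip)
    have "norm (r t) \<le> \<delta> * M + \<delta> + \<delta> + L * norm (\<psi> t)"
      unfolding r_def using 1 2 3 elim(2) by (intro norm_triangle_le add_mono) auto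
    then show ?case by (simp add: algebra_simps)
  qed
  \<comment> \<open>The summand 1 supplies the strict inequality required of \<open>m\<close>; the 2
    in the conclusion then turns the resulting weak bound into a strict one.\<close>
  moreover have "2 * N * ((M + 2) * \<delta>) / (\<nu> - 2 * N * L)
      < (2 * N * (M + 2) / (\<nu> - 2 * N * L) + 1) * \<delta>"
    using \<delta> by (simp add: algebra_simps add_divide_distrib)
  ultimately have "\<forall>\<^sub>F t in at_infinity. norm (\<psi> t) \<le> (2 * N * (M + 2) / (\<nu> - 2 * N * L) + 1) * \<delta>"
    by (rule trichotomy_asymptotic_bound[OF tri L])
  then show ?thesis
    by eventually_elim (use \<delta> in \<open>simp add: \<psi>_def algebra_simps\<close>)
qed

end

subsection \<open>Remote almost periods\<close>

definition remote_shifts :: "(real \<Rightarrow> real \<Rightarrow> real) \<Rightarrow> real \<Rightarrow> real set" where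
  "remote_shifts d \<epsilon> = {s. \<forall>\<^sub>F t in at_infinity. d s t < \<epsilon>}"

lemma relatively_dense_mono: "relatively_dense S \<Longrightarrow> S \<subseteq> T \<Longrightarrow> relatively_dense T"
  unfolding relatively_dense_def by blast

text \<open>Every set allowed in the definition lies in \<open>remote_shifts d \<epsilon>\<close>,
  and relative density passes to supersets.\<close>

lemma remotely_almost_periodic_iff:
  "remotely_almost_periodic d \<longleftrightarrow> (\<forall>\<epsilon>>0. relatively_dense (remote_shifts d \<epsilon>))"
proof -
  have *: "(\<exists>l>0. \<forall>t. \<bar>t\<bar> \<ge> l \<longrightarrow> d s t < \<epsilon>) \<longleftrightarrow> s \<in> remote_shifts d \<epsilon>" for s \<epsilon>
    by (simp add: remote_shifts_def eventually_at_infinity_pos)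
  show ?thesis
    unfolding remotely_almost_periodic_def * by (meson relatively_dense_mono subsetI)
qed

lemma remotely_periodic_imp_remote_shifts:
  "remotely_periodic \<tau> d \<Longrightarrow> \<epsilon> > 0 \<Longrightarrow> \<tau> \<in> remote_shifts d \<epsilon>"
  unfolding remotely_periodic_def remote_shifts_def mem_Collect_eq by (rule order_tendstoD)

lemma eventually_at_infinity_translate:
  fixes a :: real
  assumes "\<forall>\<^sub>F t in at_infinity. P t"
  shows "\<forall>\<^sub>F t in at_infinity. P (t - a)"
proof -
  obtain b where "\<And>t. b \<le> \<bar>t\<bar> \<Longrightarrow> P t"
    using assms unfolding eventually_at_infinity by auto
  then show ?thesis
    unfolding eventually_at_infinity by (intro exI[of _ "b + \<bar>a\<bar>"]) auto
qed

text \<open>The assumption on \<open>d\<close> is the triangle inequality through the value at time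
  \<open>t - s'\<close>, which goes to infinity with \<open>t\<close>.\<close>

lemma remote_shifts_diff:
  assumes d: "\<And>s s' t. d (s - s') t \<le> d s (t - s') + d s' (t - s')"
    and "s \<in> remote_shifts d \<epsilon>" "s' \<in> remote_shifts d \<epsilon>'"
  shows "s - s' \<in> remote_shifts d (\<epsilon> + \<epsilon>')"
proof -
  have "\<forall>\<^sub>F t in at_infinity. d s (t - s') < \<epsilon>" "\<forall>\<^sub>F t in at_infinity. d s' (t - s') < \<epsilon>'"
    using assms(2,3) by (auto simp: remote_shifts_def intro: eventually_at_infinity_translate)
  then have "\<forall>\<^sub>F t in at_infinity. d (s - s') t < \<epsilon> + \<epsilon>'"
    by eventually_elim (use d in \<open>smt (verit)\<close>)
  then show ?thesis by (simp add: remote_shifts_def)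
qed

text \<open>
  Bohr's argument: for \<open>\<sigma>\<^sub>1 a\<close>, \<open>\<sigma>\<^sub>2 a\<close> almost periods of \<open>d\<^sub>1\<close>, \<open>d\<^sub>2\<close> near \<open>a\<close>, the differences
  \<open>\<sigma>\<^sub>1 a - \<sigma>\<^sub>2 a\<close> meet only finitely many cells of length \<open>\<eta>\<close>. If \<open>a'\<close> represents the cell of
  \<open>a\<close>, then \<open>\<sigma>\<^sub>1 a - \<sigma>\<^sub>1 a'\<close> is, up to \<open>\<eta>\<close>, also an almost period of \<open>d\<^sub>2\<close>.
\<close>

lemma remotely_almost_periodic_max:
  assumes d1: "\<And>s s' t. d\<^sub>1 (s - s') t \<le> d\<^sub>1 s (t - s') + d\<^sub>1 s' (t - s')"
    and d2: "\<And>s s' t. d\<^sub>2 (s - s') t \<le> d\<^sub>2 s (t - s') + d\<^sub>2 s' (t - s')"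
    and uc: "\<And>\<epsilon>. \<epsilon> > 0 \<Longrightarrow> \<exists>\<eta>>0. \<forall>\<theta> t. \<bar>\<theta>\<bar> < \<eta> \<longrightarrow> d\<^sub>2 \<theta> t < \<epsilon>"
    and rap: "remotely_almost_periodic d\<^sub>1" "remotely_almost_periodic d\<^sub>2"
  shows "remotely_almost_periodic (\<lambda>s t. max (d\<^sub>1 s t) (d\<^sub>2 s t))"
  unfolding remotely_almost_periodic_iff
proof (intro allI impI)
  fix \<epsilon> :: real assume "\<epsilon> > 0"
  define e where "e = \<epsilon> / 3"
  have e: "e > 0" using \<open>\<epsilon> > 0\<close> by (simp add: e_def)
  obtain \<eta> where \<eta>: "\<eta> > 0" "\<And>\<theta> t. \<bar>\<theta>\<bar> < \<eta> \<Longrightarrow> d\<^sub>2 \<theta> t < e"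
    using uc[OF e] by blast
  obtain l1 where l1: "l1 > 0" "\<And>a. {a..a + l1} \<inter> remote_shifts d\<^sub>1 e \<noteq> {}"
    using rap(1) e unfolding remotely_almost_periodic_iff relatively_dense_def by blast
  obtain l2 where l2: "l2 > 0" "\<And>a. {a..a + l2} \<inter> remote_shifts d\<^sub>2 e \<noteq> {}"
    using rap(2) e unfolding remotely_almost_periodic_iff relatively_dense_def by blast
  have "\<exists>s. s \<in> remote_shifts d\<^sub>1 e \<and> a \<le> s \<and> s \<le> a + l1" for a using l1(2)[of a] by auto
  then obtain \<sigma>\<^sub>1 where \<sigma>1: "\<And>a. \<sigma>\<^sub>1 a \<in> remote_shifts d\<^sub>1 e" "\<And>a. a \<le> \<sigma>\<^sub>1 a" "\<And>a. \<sigma>\<^sub>1 a \<le> a + l1"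
    by metis
  have "\<exists>s. s \<in> remote_shifts d\<^sub>2 e \<and> a \<le> s \<and> s \<le> a + l2" for a using l2(2)[of a] by auto
  then obtain \<sigma>\<^sub>2 where \<sigma>2: "\<And>a. \<sigma>\<^sub>2 a \<in> remote_shifts d\<^sub>2 e" "\<And>a. a \<le> \<sigma>\<^sub>2 a" "\<And>a. \<sigma>\<^sub>2 a \<le> a + l2"
    by metis
  define cell where "cell a = \<lfloor>(\<sigma>\<^sub>1 a - \<sigma>\<^sub>2 a) / \<eta>\<rfloor>" for a
  \<comment> \<open>One representative per cell: finitely many cells make
    \<open>\<sigma>\<^sub>1 (rep a)\<close> bounded uniformly in \<open>a\<close>.\<close>
  define rep where "rep a = inv cell (cell a)" for a
  have "cell a \<in> {\<lfloor>- l2 / \<eta>\<rfloor>..\<lfloor>l1 / \<eta>\<rfloor>}" for a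
  proof -
    have "- l2 \<le> \<sigma>\<^sub>1 a - \<sigma>\<^sub>2 a" "\<sigma>\<^sub>1 a - \<sigma>\<^sub>2 a \<le> l1"
      using \<sigma>1[of a] \<sigma>2[of a] by linarith+
    then have "- l2 / \<eta> \<le> (\<sigma>\<^sub>1 a - \<sigma>\<^sub>2 a) / \<eta>" "(\<sigma>\<^sub>1 a - \<sigma>\<^sub>2 a) / \<eta> \<le> l1 / \<eta>"
      using \<eta>(1) by (intro divide_right_mono; simp)+
    then show ?thesis
      unfolding cell_def atLeastAtMost_iff by (intro conjI floor_mono)
  qed
  then have "finite (range cell)" by (meson finite_atLeastAtMost_int finite_subset image_subsetI)
  then have "finite ((\<lambda>a. \<bar>\<sigma>\<^sub>1 (rep a)\<bar>) ` UNIV)"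
    using finite_imageI[of "range cell" "\<lambda>c. \<bar>\<sigma>\<^sub>1 (inv cell c)\<bar>"] by (simp add: rep_def image_image)
  then obtain B where B: "\<And>a. \<bar>\<sigma>\<^sub>1 (rep a)\<bar> \<le> B"
    using Max_ge by blast
  have B0: "0 \<le> B" using order_trans[OF abs_ge_zero B] .
  have mem: "\<sigma>\<^sub>1 a - \<sigma>\<^sub>1 (rep a) \<in> remote_shifts (\<lambda>s t. max (d\<^sub>1 s t) (d\<^sub>2 s t)) \<epsilon>" for a
  proof -
    \<comment> \<open>The two candidate shifts differ by \<open>\<theta>\<close>, of size below
      \<open>\<eta>\<close>. Replacing one by the other costs a third \<open>e\<close> in
      \<open>d\<^sub>2\<close>.\<close>
    define \<theta> where "\<theta> = (\<sigma>\<^sub>2 a - \<sigma>\<^sub>2 (rep a)) - (\<sigma>\<^sub>1 a - \<sigma>\<^sub>1 (rep a))"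
    have "cell (rep a) = cell a" by (simp add: rep_def f_inv_into_f)
    then have "\<bar>(\<sigma>\<^sub>1 a - \<sigma>\<^sub>2 a) / \<eta> - (\<sigma>\<^sub>1 (rep a) - \<sigma>\<^sub>2 (rep a)) / \<eta>\<bar> < 1"
      unfolding cell_def by linarith
    also have "(\<sigma>\<^sub>1 a - \<sigma>\<^sub>2 a) / \<eta> - (\<sigma>\<^sub>1 (rep a) - \<sigma>\<^sub>2 (rep a)) / \<eta> = - \<theta> / \<eta>"
      using \<eta>(1) by (simp add: \<theta>_def field_simps)
    finally have "\<bar>\<theta>\<bar> < \<eta>" using \<eta>(1) by (simp add: abs_divide)
    then have \<theta>: "\<theta> \<in> remote_shifts d\<^sub>2 e"
      using \<eta>(2) by (simp add: remote_shifts_def)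
    have "\<sigma>\<^sub>1 a - \<sigma>\<^sub>1 (rep a) \<in> remote_shifts d\<^sub>1 (e + e)"
      by (intro remote_shifts_diff d1 \<sigma>1)
    moreover have "(\<sigma>\<^sub>2 a - \<sigma>\<^sub>2 (rep a)) - \<theta> \<in> remote_shifts d\<^sub>2 ((e + e) + e)"
      by (intro remote_shifts_diff d2 \<sigma>2 \<theta>)
    moreover have "(\<sigma>\<^sub>2 a - \<sigma>\<^sub>2 (rep a)) - \<theta> = \<sigma>\<^sub>1 a - \<sigma>\<^sub>1 (rep a)" by (simp add: \<theta>_def)
    ultimately have "\<forall>\<^sub>F t in at_infinity. d\<^sub>1 (\<sigma>\<^sub>1 a - \<sigma>\<^sub>1 (rep a)) t < e + e"
      "\<forall>\<^sub>F t in at_infinity. d\<^sub>2 (\<sigma>\<^sub>1 a - \<sigma>\<^sub>1 (rep a)) t < \<epsilon>"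
      by (simp_all add: remote_shifts_def e_def)
    then show ?thesis
      unfolding remote_shifts_def mem_Collect_eq
      by eventually_elim (use e in \<open>auto simp: e_def\<close>)
  qed
  show "relatively_dense (remote_shifts (\<lambda>s t. max (d\<^sub>1 s t) (d\<^sub>2 s t)) \<epsilon>)"
    unfolding relatively_dense_def
  \<comment> \<open>For \<open>a = b + B\<close>, the shift \<open>\<sigma>\<^sub>1 a\<close> lies
    in \<open>{b + B..b + B + l1}\<close>, and subtracting its representative moves it by at most
    \<open>B\<close>.\<close>
  proof (intro exI[of _ "2 * B + l1"] conjI allI)
    show "2 * B + l1 > 0" using B0 l1 by simp
    fix b
    have "\<sigma>\<^sub>1 (b + B) - \<sigma>\<^sub>1 (rep (b + B)) \<in> {b..b + (2 * B + l1)}"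
      using \<sigma>1(2,3)[of "b + B"] B[of "b + B"] by auto
    then show "{b..b + (2 * B + l1)} \<inter> remote_shifts (\<lambda>s t. max (d\<^sub>1 s t) (d\<^sub>2 s t)) \<epsilon> \<noteq> {}"
      using mem by blast
  qed
qed

subsection \<open>Lagrange stable functions\<close>

text \<open>Total boundedness of the translates on \<open>K\<close>. The sets \<open>W k\<close>
  around continuous \<open>k\<close> cover the orbit closure, since each of its elements is
  continuous and lies in its own \<open>W\<close>; compactness leaves finitely many.\<close>

lemma Lagrange_stable_finite_net:
  fixes g :: "real \<Rightarrow> 'b::metric_space"
  assumes g: "Lagrange_stable g" and K: "compact K" and e: "e > 0"
  obtains G where "finite G" "\<And>k. k \<in> G \<Longrightarrow> continuous_on UNIV k"
    "\<And>h. \<exists>k\<in>G. \<forall>t\<in>K. dist (g (t + h)) (k t) < e"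
proof -
  define X where "X = (uniform_on_compacts_topology :: (real \<Rightarrow> 'b) topology)"
  define S where "S = range (\<lambda>h t. g (t + h))"
  define C where "C = {k :: real \<Rightarrow> 'b. continuous_on UNIV k}"
  define W where "W k = {k'. continuous_on UNIV k' \<and> (\<forall>t\<in>K. dist (k' t) (k t) < e)}" for k :: "real \<Rightarrow> 'b"
  have S: "S \<subseteq> topspace X" "compactin X (X closure_of S)"
    using g by (simp_all add: Lagrange_stable_def precompact_in_def X_def S_def)
  have "openin X (W k)" if "k \<in> C" for k
    unfolding X_def uniform_on_compacts_topology_def
    by (rule topology_generated_by_Basis) (use that K e in \<open>auto simp: W_def C_def\<close>)
  moreover have "topspace X \<subseteq> C"
    unfolding X_def uniform_on_compacts_topology_def topology_generated_by_topspace
    by (auto simp: C_def)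
  then have "X closure_of S \<subseteq> \<Union> (W ` C)"
    using closure_of_subset_topspace[of X S] e by (fastforce simp: C_def W_def)
  ultimately obtain \<F> where \<F>: "finite \<F>" "\<F> \<subseteq> W ` C" "X closure_of S \<subseteq> \<Union> \<F>"
    using compactinD[OF S(2), of "W ` C"] by blast
  then obtain G where G: "G \<subseteq> C" "finite G" "\<F> = W ` G"
    by (meson finite_subset_image)
  show ?thesis
  proof
    show "finite G" by fact
    show "continuous_on UNIV k" if "k \<in> G" for k using that G by (auto simp: C_def)
    fix h
    have "(\<lambda>t. g (t + h)) \<in> X closure_of S"
      using closure_of_subset[OF S(1)] by (auto simp: S_def)
    then show "\<exists>k\<in>G. \<forall>t\<in>K. dist (g (t + h)) (k t) < e"
      using \<F>(3) G(3) by (auto simp: W_def)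
  qed
qed

text \<open>Evaluating the translates at 0 recovers all values of \<open>g\<close>, so a finite net
  over a one-point compact set suffices.\<close>

lemma Lagrange_stable_imp_bounded:
  assumes "Lagrange_stable g"
  shows "bounded (range g)"
proof -
  obtain G where G: "finite G" "\<And>h. \<exists>k\<in>G. \<forall>t\<in>{0}. dist (g (t + h)) (k t) < 1"
    using Lagrange_stable_finite_net[OF assms, of "{0}" 1] by (metis compact_sing zero_less_one)
  have "bounded (\<Union>k\<in>G. ball (k 0) 1)"
    using G(1) by auto
  moreover have "range g \<subseteq> (\<Union>k\<in>G. ball (k 0) 1)"
    using G(2) by (auto simp: dist_commute)
  ultimately show ?thesis by (rule bounded_subset)
qed

text \<open>This is uniform continuity of \<open>g\<close>: near \<open>t\<close>, a translate is
  close on \<open>{-1..1}\<close> to one of finitely many functions, and these are jointly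
  equicontinuous at 0.\<close>

lemma Lagrange_stable_shift_dist_uniformly_small:
  assumes g: "Lagrange_stable g" and e: "e > 0"
  shows "\<exists>\<eta>>0. \<forall>\<theta> t. \<bar>\<theta>\<bar> < \<eta> \<longrightarrow> shift_dist g \<theta> t < e"
proof -
  have e3: "e / 3 > 0" using e by simp
  obtain G where G: "finite G" "\<And>k. k \<in> G \<Longrightarrow> continuous_on UNIV k"
    "\<And>h. \<exists>k\<in>G. \<forall>t\<in>{-1..1}. dist (g (t + h)) (k t) < e / 3"
    using Lagrange_stable_finite_net[OF g compact_Icc e3] by blast
  have "\<forall>\<^sub>F \<theta> in nhds 0. dist (k \<theta>) (k 0) < e / 3" if "k \<in> G" for k
  proof -
    have "isCont k 0" using G(2)[OF that] by (simp add: continuous_on_eq_continuous_at)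
    then have "(k \<longlongrightarrow> k 0) (nhds 0)" by (simp add: isCont_def tendsto_nhds_iff)
    then show ?thesis using e3 by (rule tendstoD)
  qed
  then have "\<forall>\<^sub>F \<theta> in nhds 0. \<forall>k\<in>G. dist (k \<theta>) (k 0) < e / 3"
    using G(1) by (simp add: eventually_ball_finite)
  then obtain \<eta> where \<eta>: "\<eta> > 0" "\<And>\<theta> k. \<bar>\<theta>\<bar> < \<eta> \<Longrightarrow> k \<in> G \<Longrightarrow> dist (k \<theta>) (k 0) < e / 3"
    unfolding eventually_nhds_metric by auto
  show ?thesis
  proof (intro exI[of _ "min \<eta> 1"] conjI allI impI)
    fix \<theta> t assume \<theta>: "\<bar>\<theta>\<bar> < min \<eta> 1"
    obtain k where k: "k \<in> G" "\<forall>u\<in>{-1..1}. dist (g (u + t)) (k u) < e / 3"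
      using G(3) by blast
    have "dist (g (\<theta> + t)) (k \<theta>) < e / 3" "dist (g (0 + t)) (k 0) < e / 3"
      using bspec[OF k(2), of \<theta>] bspec[OF k(2), of 0] \<theta> by (simp_all add: abs_less_iff)
    moreover have "dist (k \<theta>) (k 0) < e / 3" using \<eta>(2) k(1) \<theta> by simp
    ultimately have "dist (g (\<theta> + t)) (g (0 + t)) < e"
      using dist_triangle[of "g (\<theta> + t)" "g (0 + t)" "k \<theta>"]
        dist_triangle2[of "k \<theta>" "g (0 + t)" "k 0"] by linarith
    then show "shift_dist g \<theta> t < e" by (simp add: shift_dist_def add.commute)
  qed (use \<eta> in simp)
qed

subsection \<open>The shift distances\<close>

lemma shift_dist_triangle: "shift_dist g (s - s') t \<le> shift_dist g s (t - s') + shift_dist g s' (t - s')"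
  using dist_triangle2[of "g (t + (s - s'))" "g t" "g (t - s')"]
  by (simp add: shift_dist_def algebra_simps dist_commute)

text \<open>Boundedness of \<open>F\<close> makes the supremum of real numbers a genuine upper
  bound.\<close>

lemma shift_dist_on_upper:
  assumes "\<And>t x. x \<in> K \<Longrightarrow> norm (F (t, x)) \<le> B" "x \<in> K"
  shows "norm (F (t + s, x) - F (t, x)) \<le> shift_dist_on K F s t"
  unfolding shift_dist_on_def
proof (rule cSUP_upper[OF assms(2) bdd_aboveI2])
  show "norm (F (t + s, y) - F (t, y)) \<le> B + B" if "y \<in> K" for y
    by (intro norm_triangle_le_diff add_mono assms(1) that)
qed

lemma shift_dist_on_triangle:
  assumes B: "\<And>t x. x \<in> K \<Longrightarrow> norm (F (t, x)) \<le> B" and "K \<noteq> {}"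
  shows "shift_dist_on K F (s - s') t \<le> shift_dist_on K F s (t - s') + shift_dist_on K F s' (t - s')"
  unfolding shift_dist_on_def[of K F "s - s'"]
proof (rule cSUP_least[OF assms(2)])
  fix x assume x: "x \<in> K"
  have "norm (F (t + (s - s'), x) - F (t, x)) \<le>
      norm (F (t - s' + s, x) - F (t - s', x)) + norm (F (t - s' + s', x) - F (t - s', x))"
    using norm_triangle_ineq4[of "F (t - s' + s, x) - F (t - s', x)" "F (t - s' + s', x) - F (t - s', x)"]
    by (simp add: algebra_simps)
  also have "\<dots> \<le> shift_dist_on K F s (t - s') + shift_dist_on K F s' (t - s')"
    by (intro add_mono shift_dist_on_upper[where F = F and B = B] B x)
  finally show "norm (F (t + (s - s'), x) - F (t, x)) \<le> \<dots>" .
qed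

subsection \<open>Remote almost periodicity of the solution\<close>

theorem corollary6p22:
  fixes A U :: "real \<Rightarrow> 'a::banach \<Rightarrow>\<^sub>L 'a"
    and f \<phi> :: "real \<Rightarrow> 'a"
    and F :: "real \<times> 'a \<Rightarrow> 'a"
    and P Q :: "'a \<Rightarrow>\<^sub>L 'a"
    and \<tau>\<^sub>0 N \<nu> L :: real
    and Q\<phi> :: "'a set"
  assumes "continuous_on UNIV f"
    and "continuous_on UNIV F"
    and "\<And>t. F (t, 0) = 0"
    and "continuous_on UNIV A"
    and "\<tau>\<^sub>0 > 0"
    and "Cauchy_operator A U"
    and "exponential_trichotomy U P Q N \<nu>"
    and "Lagrange_stable A"
    and "Lagrange_stable f"
    and "Lagrange_stable_param F"
    and "\<And>t u\<^sub>1 u\<^sub>2. norm (F (t, u\<^sub>1) - F (t, u\<^sub>2)) \<le> L * norm (u\<^sub>1 - u\<^sub>2)"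
    and "L < \<nu> / (2 * N)"
    and "precompact_in euclidean (range (\<lambda>t. transported U P t t))"
    and "Lagrange_stable \<phi>"
    and "\<And>t. (\<phi> has_vector_derivative (blinfun_apply (A t) (\<phi> t) + f t + F (t, \<phi> t))) (at t)"
    and "\<And>t. ((\<lambda>\<tau>. blinfun_apply (Green_function U P Q t \<tau>) (f \<tau> + F (\<tau>, \<phi> \<tau>)))
               has_integral \<phi> t) UNIV"
    and "Q\<phi> = closure (range \<phi>)"
  shows "(remotely_stationary (shift_dist A) \<and>
          remotely_stationary (shift_dist f) \<and>
          remotely_stationary (shift_dist_on Q\<phi> F)
            \<longrightarrow> remotely_stationary (shift_dist \<phi>)) \<and>
         (remotely_periodic \<tau>\<^sub>0 (shift_dist A) \<and>
          remotely_periodic \<tau>\<^sub>0 (shift_dist f) \<and>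
          remotely_periodic \<tau>\<^sub>0 (shift_dist_on Q\<phi> F)
            \<longrightarrow> remotely_periodic \<tau>\<^sub>0 (shift_dist \<phi>)) \<and>
         (remotely_almost_periodic (shift_dist A) \<and>
          remotely_almost_periodic (shift_dist f) \<and>
          remotely_almost_periodic (shift_dist_on Q\<phi> F)
            \<longrightarrow> remotely_almost_periodic (shift_dist \<phi>))"
  proof -
  interpret linear_equation A U
    using assms(4,6) by unfold_locales
  have N: "N > 0" and \<nu>: "\<nu> > 0"
    using assms(7) by (simp_all add: exponential_trichotomy_def)
  \<comment> \<open>\<open>L\<close> may be negative when the space is trivial.\<close>
  define K where "K = max 0 L"
  have K: "0 \<le> K" "K < \<nu> / (2 * N)"
    using N \<nu> assms(12) by (simp_all add: K_def)
  have lip: "norm (F (t, x) - F (t, y)) \<le> K * norm (x - y)" for t x y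
    using assms(11) by (rule order_trans) (simp add: K_def mult_right_mono)
  obtain M where M: "\<And>t. norm (\<phi> t) \<le> M"
    using Lagrange_stable_imp_bounded[OF assms(14)] by (auto simp: bounded_iff)
  have M0: "0 \<le> M" using order_trans[OF norm_ge_zero M] .
  have "Q\<phi> \<subseteq> cball 0 M"
    unfolding assms(17) using M by (intro closure_minimal) auto
  \<comment> \<open>Compare with \<open>F (t, 0) = 0\<close> by the Lipschitz condition.\<close>
  then have F_bound: "norm (F (t, x)) \<le> K * M" if "x \<in> Q\<phi>" for t x
    using lip[of t x 0] assms(3) that mult_left_mono[OF _ K(1), of "norm x" M] by auto
  have \<phi>_mem: "\<phi> t \<in> Q\<phi>" for t
    unfolding assms(17) by (rule subsetD[OF closure_subset]) simp
  \<comment> \<open>The factor from \<open>solution_shift_bound\<close>: accuracy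
    \<open>\<epsilon> / c\<close> in the data yields accuracy \<open>\<epsilon>\<close> in the
    solution, for the same shift.\<close>
  define c where "c = 2 * N * (M + 2) / (\<nu> - 2 * N * K) + 2"
  have "\<nu> - 2 * N * K > 0" using K N by (simp add: field_simps)
  then have c: "c > 0" using N M0 by (simp add: c_def add_nonneg_pos)
  have key: "s \<in> remote_shifts (shift_dist \<phi>) \<epsilon>"
    if \<epsilon>: "\<epsilon> > 0" and s: "s \<in> remote_shifts (shift_dist A) (\<epsilon> / c)"
      "s \<in> remote_shifts (shift_dist f) (\<epsilon> / c)" "s \<in> remote_shifts (shift_dist_on Q\<phi> F) (\<epsilon> / c)"
    for s \<epsilon>
  proof -
    have "\<forall>\<^sub>F t in at_infinity. shift_dist_on Q\<phi> F s t < \<epsilon> / c"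
      using s(3) by (simp add: remote_shifts_def)
    then have "\<forall>\<^sub>F t in at_infinity. \<forall>u. norm (F (t + s, \<phi> u) - F (t, \<phi> u)) < \<epsilon> / c"
      by eventually_elim (blast intro: le_less_trans shift_dist_on_upper F_bound \<phi>_mem)
    then have "\<forall>\<^sub>F t in at_infinity. norm (\<phi> (t + s) - \<phi> t) < c * (\<epsilon> / c)"
      unfolding c_def
      using s(1,2) \<epsilon> c
      by (intro solution_shift_bound[OF assms(7) K lip assms(15) M])
        (simp_all add: remote_shifts_def shift_dist_def dist_norm c_def)
    then show ?thesis using c by (simp add: remote_shifts_def shift_dist_def dist_norm)
  qed
  have periodic: "remotely_periodic \<tau> (shift_dist \<phi>)"
    if "remotely_periodic \<tau> (shift_dist A)" "remotely_periodic \<tau> (shift_dist f)"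
      "remotely_periodic \<tau> (shift_dist_on Q\<phi> F)" for \<tau>
    unfolding remotely_periodic_def
  proof (rule tendstoI)
    fix \<epsilon> :: real assume \<epsilon>: "\<epsilon> > 0"
    have "\<tau> \<in> remote_shifts (shift_dist \<phi>) \<epsilon>"
      using \<epsilon> c that by (intro key remotely_periodic_imp_remote_shifts) simp_all
    then show "\<forall>\<^sub>F t in at_infinity. dist (shift_dist \<phi> \<tau> t) 0 < \<epsilon>"
      by (simp add: remote_shifts_def shift_dist_def)
  qed
  have almost_periodic: "remotely_almost_periodic (shift_dist \<phi>)"
    if rap: "remotely_almost_periodic (shift_dist A)" "remotely_almost_periodic (shift_dist f)"
      "remotely_almost_periodic (shift_dist_on Q\<phi> F)"
  proof -
    define d where "d s t = max (shift_dist A s t) (shift_dist f s t)" for s t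
    have d_triangle: "d (s - s') t \<le> d s (t - s') + d s' (t - s')" for s s' t
      using shift_dist_triangle[of A s s' t] shift_dist_triangle[of f s s' t]
      unfolding d_def by linarith
    have d_small: "\<exists>\<eta>>0. \<forall>\<theta> t. \<bar>\<theta>\<bar> < \<eta> \<longrightarrow> d \<theta> t < \<epsilon>" if \<epsilon>: "\<epsilon> > 0" for \<epsilon>
    proof -
      obtain \<eta>\<^sub>1 \<eta>\<^sub>2 where "\<eta>\<^sub>1 > 0" "\<And>\<theta> t. \<bar>\<theta>\<bar> < \<eta>\<^sub>1 \<Longrightarrow> shift_dist A \<theta> t < \<epsilon>"
        and "\<eta>\<^sub>2 > 0" "\<And>\<theta> t. \<bar>\<theta>\<bar> < \<eta>\<^sub>2 \<Longrightarrow> shift_dist f \<theta> t < \<epsilon>"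
        using Lagrange_stable_shift_dist_uniformly_small[OF assms(8) \<epsilon>]
          Lagrange_stable_shift_dist_uniformly_small[OF assms(9) \<epsilon>] by metis
      then show ?thesis by (intro exI[of _ "min \<eta>\<^sub>1 \<eta>\<^sub>2"]) (simp add: d_def)
    qed
    have "Q\<phi> \<noteq> {}" using \<phi>_mem by blast
    \<comment> \<open>Bohr's argument is applied twice, first to \<open>A\<close> and
      \<open>f\<close>, then to \<open>F\<close> and the pair \<open>d\<close>. It asks for uniform
      smallness of its second distance, so \<open>F\<close> comes first.\<close>
    moreover have "remotely_almost_periodic d"
      unfolding d_def
      by (intro remotely_almost_periodic_max shift_dist_triangle
          Lagrange_stable_shift_dist_uniformly_small assms(9) rap)
    ultimately have common: "remotely_almost_periodic (\<lambda>s t. max (shift_dist_on Q\<phi> F s t) (d s t))"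
      by (intro remotely_almost_periodic_max shift_dist_on_triangle[where B = "K * M"]
          F_bound d_triangle d_small rap)
    show ?thesis
      unfolding remotely_almost_periodic_iff
    proof (intro allI impI)
      fix \<epsilon> :: real assume \<epsilon>: "\<epsilon> > 0"
      have "relatively_dense (remote_shifts (\<lambda>s t. max (shift_dist_on Q\<phi> F s t) (d s t)) (\<epsilon> / c))"
        using common \<epsilon> c unfolding remotely_almost_periodic_iff by simp
      moreover have "remote_shifts (\<lambda>s t. max (shift_dist_on Q\<phi> F s t) (d s t)) (\<epsilon> / c)
          \<subseteq> remote_shifts (shift_dist \<phi>) \<epsilon>"
        using key[OF \<epsilon>] by (auto simp: remote_shifts_def d_def eventually_conj_iff)
      ultimately show "relatively_dense (remote_shifts (shift_dist \<phi>) \<epsilon>)"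
        by (rule relatively_dense_mono)
    qed
  qed
  show ?thesis
    using periodic almost_periodic by (simp add: remotely_stationary_def)
qed

end
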